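(* (i) $\mathcal{C}$ is a proper subset of $\mathcal{S}'$. (ii) $\mathcal{C}'$ is a proper subset of $\mathcal{S}\cap\mathcal{C}$. (iii) $\mathcal{C}'_3=\mathcal{S}\cap\mathcal{C}_3$.
   Context: For an integer base $g\ge 2$ and integer $m\ge 0$, $s_g(m)$ denotes the sum of the base-$g$ digits of $m$; $s_1(m):=0$. A positive integer $m$ has an $s$-decomposition if $m=\prod_{\nu=1}^n g_\nu^{e_\nu}$ with exponents $e_\nu\ge1$ and proper factors $1<g_\nu<m$, strictly increasing $g_1<\dots<g_n$ (not necessarily coprime), such that $s_{g_\nu}(m)\ge g_\nu$ for each $\nu$; it is strict if $s_{g_\nu}(m)=g_\nu$ for each $\nu$. $\mathcal{S}'$ (resp. $\mathcal{S}$) is the set of positive integers having an $s$-decomposition (resp. strict $s$-decomposition). $\mathcal{C}$ is the set of Carmichael numbers (composite positive integers $m$ with $a^{m-1}\equiv1\pmod m$ for all integers $a$ coprime to $m$), and $\mathcal{C}_n$ the subset of those with exactly $n$ prime factors. $\mathcal{C}'$ is the set of squarefree integers $m>1$ with $s_p(m)=p$ for every prime $p\mid m$, and $\mathcal{C}'_n$ the subset of those with exactly $n$ prime factors. *)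

theory Defs
  imports "HOL-Number_Theory.Number_Theory" "HOL-Computational_Algebra.Squarefree"
begin

text \<open>Sum of the base-\<open>g\<close> digits of \<open>m\<close>; the degenerate bases \<open>g < 2\<close> give \<open>0\<close>,
  in accordance with the convention \<open>s\<^sub>1(m) = 0\<close>.\<close>

function digit_sum :: "nat \<Rightarrow> nat \<Rightarrow> nat" where
  "digit_sum g m = (if g < 2 \<or> m = 0 then 0 else m mod g + digit_sum g (m div g))"
  by auto
termination
  by (relation "measure snd") auto

declare digit_sum.simps [simp del]

text \<open>The factors are \<open>g 1 < \<dots> < g n\<close> with exponents \<open>e 1, \<dots>, e n\<close>. The requirement \<open>n \<ge> 1\<close>
  excludes the empty product, which would otherwise make \<open>m = 1\<close> decomposable.\<close>

definition is_factor_decomposition ::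
    "nat \<Rightarrow> nat \<Rightarrow> (nat \<Rightarrow> nat) \<Rightarrow> (nat \<Rightarrow> nat) \<Rightarrow> bool" where
  "is_factor_decomposition m n g e \<longleftrightarrow>
     n \<ge> 1 \<and> strict_mono_on {1..n} g \<and>
     (\<forall>i\<in>{1..n}. 1 < g i \<and> g i < m \<and> e i \<ge> 1) \<and>
     m = (\<Prod>i=1..n. g i ^ e i)"

definition has_s_decomposition :: "nat \<Rightarrow> bool" where
  "has_s_decomposition m \<longleftrightarrow>
     (\<exists>n g e. is_factor_decomposition m n g e \<and> (\<forall>i\<in>{1..n}. digit_sum (g i) m \<ge> g i))"

definition has_strict_s_decomposition :: "nat \<Rightarrow> bool" where
  "has_strict_s_decomposition m \<longleftrightarrow>
     (\<exists>n g e. is_factor_decomposition m n g e \<and> (\<forall>i\<in>{1..n}. digit_sum (g i) m = g i))"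

definition S_weak :: "nat set" where
  "S_weak = {m. m > 0 \<and> has_s_decomposition m}"

definition S_strict :: "nat set" where
  "S_strict = {m. m > 0 \<and> has_strict_s_decomposition m}"

definition carmichael_numbers :: "nat set" where
  "carmichael_numbers =
     {m. m > 1 \<and> \<not> prime m \<and> (\<forall>a::int. coprime a (int m) \<longrightarrow> [a ^ (m - 1) = 1] (mod int m))}"

definition primary_carmichael_numbers :: "nat set" where
  "primary_carmichael_numbers =
     {m. m > 1 \<and> squarefree m \<and> (\<forall>p. prime p \<and> p dvd m \<longrightarrow> digit_sum p m = p)}"

text \<open>Distinct prime factors are counted; all sets to which this is applied consist of
  squarefree numbers, for which counting with multiplicity gives the same.\<close>

definition with_prime_factors :: "nat set \<Rightarrow> nat \<Rightarrow> nat set" where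
  "with_prime_factors A n = {m \<in> A. card (prime_factors m) = n}"

end

theory Submission
  imports Defs
begin

text \<open>
  Korselt's criterion, obtained from the structure of Carmichael's function, says that a composite
  \<open>m\<close> is a Carmichael number iff it is squarefree and \<open>p - 1\<close> divides \<open>m - 1\<close> for all primes
  \<open>p\<close> dividing \<open>m\<close>. Since \<open>s\<^sub>p(m) \<equiv> m\<close> modulo \<open>p - 1\<close>, this forces \<open>s\<^sub>p(m) \<ge> p\<close> unless
  \<open>s\<^sub>p(m) = 1\<close>, that is, unless \<open>m\<close> is a power of \<open>p\<close>; conversely, \<open>s\<^sub>p(m) = p\<close> yields Korselt's
  condition. So the prime factorisation is an \<open>s\<close>-decomposition, and properness is witnessed by
  \<open>24 = 2\<^sup>3 \<cdot> 3\<close> and \<open>172081 = 31 \<cdot> 61 \<cdot> 91\<close> with \<open>91 = 7 \<cdot> 13\<close>. A strict decomposition of a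
  squarefree number cannot have exactly two factors \<open>g < h\<close>, because \<open>s\<^sub>h(g h) = s\<^sub>h(g) = g < h\<close>;
  so with three prime factors it has three factors, which must be the primes themselves.
\<close>

section \<open>Digit sums in a fixed base\<close>

lemma digit_sum_0 [simp]: "digit_sum g 0 = 0"
  by (simp add: digit_sum.simps)

lemma digit_sum_rec: "g \<ge> 2 \<Longrightarrow> digit_sum g m = m mod g + digit_sum g (m div g)"
  by (cases "m = 0") (simp_all add: digit_sum.simps[of g m])

lemma digit_sum_less_base: "g \<ge> 2 \<Longrightarrow> m < g \<Longrightarrow> digit_sum g m = m"
  by (simp add: digit_sum_rec)

text \<open>Evaluates concrete digit sums by rewriting. A quotient that reaches 1 is no longer of
  the form \<open>numeral\<close>, and \<open>digit_sum_less_base\<close> finishes it.\<close>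

lemma digit_sum_numeral:
  "numeral b \<ge> (2 :: nat) \<Longrightarrow> digit_sum (numeral b) (numeral m) =
     numeral m mod numeral b + digit_sum (numeral b) (numeral m div numeral b)"
  by (rule digit_sum_rec)

lemma digit_sum_mult_base: "g \<ge> 2 \<Longrightarrow> digit_sum g (g * m) = digit_sum g m"
  by (simp add: digit_sum_rec[of g "g * m"])

lemma digit_sum_pos:
  assumes "g \<ge> 2" "m > 0"
  shows "digit_sum g m > 0"
  using assms(2)
proof (induction m rule: less_induct)
  case (less m)
  show ?case
  proof (cases "m < g")
    case True
    then show ?thesis using less.prems assms(1) by (simp add: digit_sum_less_base)
  next
    case False
    then have "digit_sum g (m div g) > 0"
      using less assms(1) by (intro less.IH) (auto simp: div_greater_zero_iff)
    then show ?thesis using assms(1) by (simp add: digit_sum_rec[of g m])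
  qed
qed

text \<open>Casting out \<open>g - 1\<close>: the base is 1 modulo \<open>g - 1\<close>, hence so is
  every place value.\<close>

lemma digit_sum_cong:
  assumes "g \<ge> 2"
  shows "[digit_sum g m = m] (mod (g - 1))"
proof (induction m rule: less_induct)
  case (less m)
  show ?case
  proof (cases "m = 0")
    case False
    have g1: "[1 = g] (mod (g - 1))"
      using assms by (intro cong_sym[of g]) (simp add: cong_altdef_nat)
    have "[digit_sum g (m div g) = m div g] (mod (g - 1))"
      using less.IH[of "m div g"] False assms by auto
    moreover have "[1 * (m div g) = g * (m div g)] (mod (g - 1))"
      by (intro cong_mult g1) simp
    ultimately have "[digit_sum g (m div g) = g * (m div g)] (mod (g - 1))"
      using cong_trans by simp blast
    then have "[m mod g + digit_sum g (m div g) = m mod g + g * (m div g)] (mod (g - 1))"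
      by (intro cong_add) simp
    then show ?thesis using assms by (simp add: digit_sum_rec[of g m])
  qed simp
qed

lemma digit_sum_eq_1_imp_power:
  assumes "g \<ge> 2" "digit_sum g m = 1"
  shows "\<exists>k. m = g ^ k"
  using assms(2)
proof (induction m rule: less_induct)
  case (less m)
  show ?case
  proof (cases "m < g")
    case True
    then show ?thesis
      using less.prems assms(1) by (intro exI[of _ 0]) (simp add: digit_sum_less_base)
  next
    case False
    then have pos: "m div g > 0" "m div g < m"
      using assms(1) by (auto simp: div_greater_zero_iff)
    have eq: "m mod g + digit_sum g (m div g) = 1"
      using less.prems assms(1) by (simp add: digit_sum_rec[of g m])
    \<comment> \<open>The nonzero quotient takes up the whole digit sum, so the last digit must be
      0.\<close>
    moreover have "digit_sum g (m div g) > 0"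
      using pos assms(1) by (intro digit_sum_pos)
    ultimately have "m mod g = 0" "digit_sum g (m div g) = 1"
      by linarith+
    moreover from this obtain k where "m div g = g ^ k"
      using less.IH pos by blast
    ultimately have "m = g ^ Suc k"
      using mult_div_mod_eq[of g m] by simp
    then show ?thesis by blast
  qed
qed

section \<open>Squarefree numbers and Korselt's criterion\<close>

lemma prod_prime_factors_squarefree:
  fixes m :: nat
  assumes "squarefree m"
  shows "\<Prod>(prime_factors m) = m"
proof -
  have m: "m \<noteq> 0" using assms by (intro notI) simp
  then have "m = (\<Prod>p\<in>prime_factors m. p ^ multiplicity p m)"
    using prime_factorization_nat by blast
  also have "\<dots> = \<Prod>(prime_factors m)"
    using squarefree_factorial_semiring'[OF m] assms by (intro prod.cong) auto
  finally show ?thesis by simp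
qed

text \<open>\<open>Carmichael m\<close> is the exponent of the group of units modulo
  \<open>m\<close>. It is attained as the order of a single residue, and testing that residue alone
  gives the forward direction.\<close>

lemma carmichael_numbers_iff_Carmichael_dvd:
  "m \<in> carmichael_numbers \<longleftrightarrow> m > 1 \<and> \<not> prime m \<and> Carmichael m dvd m - 1"
proof
  assume m: "m \<in> carmichael_numbers"
  then have "m > 1" by (simp add: carmichael_numbers_def)
  then obtain g where g: "g \<in> totatives m" "ord m g = Carmichael m"
    using Carmichael_root_exists[of m] by auto
  then have "coprime (int g) (int m)" by (simp add: totatives_def)
  then have "[int g ^ (m - 1) = 1] (mod int m)"
    using m by (simp add: carmichael_numbers_def)
  then have "[g ^ (m - 1) = 1] (mod m)"
    by (metis cong_int_iff of_nat_1 of_nat_power)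
  then show "m > 1 \<and> \<not> prime m \<and> Carmichael m dvd m - 1"
    using m g by (simp add: carmichael_numbers_def ord_divides')
next
  assume m: "m > 1 \<and> \<not> prime m \<and> Carmichael m dvd m - 1"
  have "[a ^ (m - 1) = 1] (mod int m)" if a: "coprime a (int m)" for a :: int
  proof -
    \<comment> \<open>The bases are integers, while \<open>Carmichael_divides\<close> speaks of
      naturals; the least nonnegative residue passes from one to the other.\<close>
    define b where "b = nat (a mod int m)"
    have b: "[a = int b] (mod int m)"
      using m by (simp add: b_def cong_def)
    then have "coprime (int b) (int m)"
      using a cong_imp_coprime by blast
    then have "[b ^ (m - 1) = 1] (mod m)"
      using m by (intro Carmichael_divides) (auto simp: coprime_commute)
    then have "[int b ^ (m - 1) = 1] (mod int m)"
      by (metis cong_int_iff of_nat_1 of_nat_power)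
    then show ?thesis
      using cong_pow[OF b] cong_trans by blast
  qed
  then show "m \<in> carmichael_numbers"
    using m by (simp add: carmichael_numbers_def)
qed

lemma prime_dvd_Carmichael_if_square_dvd:
  assumes "prime p" "p ^ 2 dvd m" "m \<noteq> 0"
  shows "p dvd Carmichael m"
proof -
  define k where "k = multiplicity p m"
  have k: "k \<ge> 2"
    unfolding k_def using assms prime_gt_1_nat[of p]
    by (intro multiplicity_geI) (auto intro: finite_divisor_powers)
  have p: "p \<in> prime_factors m"
    using assms by (auto simp: in_prime_factors_iff power2_eq_square dest: dvd_mult_left)
  \<comment> \<open>This is the local term of the closed formula for \<open>Carmichael m\<close>.
    Since \<open>k \<ge> 2\<close>, both \<open>k - 1\<close> and \<open>k - 2\<close> in its
    special case \<open>k > 2\<close> are positive, so a factor \<open>p\<close> remains.\<close>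
  have "p dvd (if p = 2 \<and> k > 2 then 2 ^ (k - 2) else p ^ (k - 1) * (p - 1))"
    using k by auto
  also have "\<dots> dvd Carmichael m"
    unfolding Carmichael_closed_formula[of m]
    using p by (intro dvd_Lcm image_eqI[of _ _ p]) (simp_all only: k_def Let_def)
  finally show ?thesis .
qed

theorem korselt_criterion:
  "m \<in> carmichael_numbers \<longleftrightarrow>
     m > 1 \<and> \<not> prime m \<and> squarefree m \<and> (\<forall>p. prime p \<and> p dvd m \<longrightarrow> p - 1 dvd m - 1)"
proof -
  have "Carmichael m dvd m - 1 \<longleftrightarrow>
      squarefree m \<and> (\<forall>p. prime p \<and> p dvd m \<longrightarrow> p - 1 dvd m - 1)" if m: "m > 1"
  proof -
    have sf: "squarefree m" if dvd: "Carmichael m dvd m - 1"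
    proof (rule ccontr)
      assume "\<not> squarefree m"
      then obtain p where p: "prime p" "p ^ 2 dvd m"
        using m by (auto simp: squarefree_factorial_semiring)
      then have "p dvd Carmichael m"
        using m by (intro prime_dvd_Carmichael_if_square_dvd) auto
      then have "p dvd m - 1" using dvd by (rule dvd_trans)
      moreover have "p dvd m"
        using p by (simp add: power2_eq_square dvd_mult_left)
      ultimately have "p dvd 1"
        using m dvd_diff_nat[of p m "m - 1"] by simp
      then show False using p by simp
    qed
    \<comment> \<open>With multiplicity 1 the local term reduces to \<open>p - 1\<close>.\<close>
    have "Carmichael m = (LCM p\<in>prime_factors m. p - 1)" if sf: "squarefree m"
    proof -
      have "multiplicity p m = 1" if "p \<in> prime_factors m" for p
        using sf that m by (simp add: squarefree_factorial_semiring')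
      then show ?thesis
        unfolding Carmichael_closed_formula
        by (intro arg_cong[of _ _ Lcm] image_cong) auto
    qed
    then have "Carmichael m dvd m - 1 \<longleftrightarrow> (\<forall>p. prime p \<and> p dvd m \<longrightarrow> p - 1 dvd m - 1)"
      if "squarefree m"
      using that m by (auto simp: Lcm_dvd_iff in_prime_factors_iff)
    with sf show ?thesis by blast
  qed
  then show ?thesis
    unfolding carmichael_numbers_iff_Carmichael_dvd by blast
qed

section \<open>Decompositions as finite sets of factors\<close>

lemma factor_decomposition_iff_set:
  "m > 0 \<and> (\<exists>n g e. is_factor_decomposition m n g e \<and> (\<forall>i\<in>{1..n}. P (g i))) \<longleftrightarrow>
   (\<exists>A e. finite A \<and> A \<noteq> {} \<and> (\<forall>x\<in>A. 1 < x \<and> x < m \<and> e x \<ge> 1 \<and> P x) \<and> m = (\<Prod>x\<in>A. x ^ e x))"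
  (is "?L \<longleftrightarrow> ?R")
proof
  assume ?L
  then obtain n g e where d: "is_factor_decomposition m n g e" and P: "\<forall>i\<in>{1..n}. P (g i)"
    by blast
  \<comment> \<open>Exponents belong to positions on the left and to the factors themselves on the
    right; the inverse of \<open>g\<close> translates.\<close>
  define f where "f = the_inv_into {1..n} g"
  have inj: "inj_on g {1..n}"
    using d by (auto simp: is_factor_decomposition_def intro: strict_mono_on_imp_inj_on)
  have f: "f (g i) = i" if "i \<in> {1..n}" for i
    using that inj by (simp add: f_def the_inv_into_f_f)
  have "(\<Prod>x\<in>g ` {1..n}. x ^ e (f x)) = (\<Prod>i=1..n. g i ^ e i)"
    using inj f by (simp add: prod.reindex)
  then show ?R
    using d P f by (intro exI[of _ "g ` {1..n}"] exI[of _ "e \<circ> f"])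
      (auto simp: is_factor_decomposition_def)
next
  assume ?R
  then obtain A e where A: "finite A" "A \<noteq> {}"
      "\<forall>x\<in>A. 1 < x \<and> x < m \<and> e x \<ge> 1 \<and> P x" "m = (\<Prod>x\<in>A. x ^ e x)"
    by blast
  obtain h where h: "bij_betw h {..<card A} A" "strict_mono_on {..<card A} h"
    using ex_bij_betw_strict_mono_card[OF A(1)] by blast
  \<comment> \<open>The increasing enumeration \<open>h\<close> starts at 0, the factors of a
    decomposition at 1.\<close>
  define g where "g = (\<lambda>i. h (i - 1))"
  have bij: "bij_betw g {1..card A} A"
  proof -
    have "bij_betw (\<lambda>i. i - 1) {1..card A} {..<card A}"
      by (rule bij_betwI[of _ _ _ Suc]) auto
    then show ?thesis
      using bij_betw_trans[OF _ h(1)] by (simp add: g_def comp_def)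
  qed
  have mono: "strict_mono_on {1..card A} g"
  proof (rule strict_mono_onI)
    fix r s assume "r \<in> {1..card A}" "s \<in> {1..card A}" "r < s"
    then show "g r < g s"
      unfolding g_def by (intro strict_mono_onD[OF h(2)]) auto
  qed
  have gA: "g i \<in> A" if "i \<in> {1..card A}" for i
    using bij that by (auto simp: bij_betw_def)
  have "m = (\<Prod>i=1..card A. g i ^ e (g i))"
    unfolding A(4) by (rule prod.reindex_bij_betw[OF bij, symmetric])
  moreover have "card A \<ge> 1"
    using A by (simp add: Suc_le_eq card_gt_0_iff)
  moreover obtain x where "x \<in> A" using A(2) by blast
  then have "m > 0" using A(3) by fastforce
  ultimately show ?L
    using A(3) gA mono
    by (intro conjI exI[of _ "card A"] exI[of _ g] exI[of _ "e \<circ> g"])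
      (auto simp: is_factor_decomposition_def)
qed

lemma S_weak_iff:
  "m \<in> S_weak \<longleftrightarrow> (\<exists>A e. finite A \<and> A \<noteq> {} \<and>
     (\<forall>x\<in>A. 1 < x \<and> x < m \<and> e x \<ge> 1 \<and> digit_sum x m \<ge> x) \<and> m = (\<Prod>x\<in>A. x ^ e x))"
  unfolding S_weak_def has_s_decomposition_def mem_Collect_eq
  by (rule factor_decomposition_iff_set)

lemma S_strict_iff:
  "m \<in> S_strict \<longleftrightarrow> (\<exists>A e. finite A \<and> A \<noteq> {} \<and>
     (\<forall>x\<in>A. 1 < x \<and> x < m \<and> e x \<ge> 1 \<and> digit_sum x m = x) \<and> m = (\<Prod>x\<in>A. x ^ e x))"
  unfolding S_strict_def has_strict_s_decomposition_def mem_Collect_eq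
  by (rule factor_decomposition_iff_set)

section \<open>Inclusions between the sets, and the case of three prime factors\<close>

lemma prime_factor_less:
  fixes m :: nat
  assumes "m > 1" "\<not> prime m" "p \<in> prime_factors m"
  shows "1 < p \<and> p < m"
  using assms prime_gt_1_nat[of p] dvd_imp_le[of p m]
  by (cases "p = m") (auto simp: in_prime_factors_iff)

lemma carmichael_subset_S_weak: "carmichael_numbers \<subseteq> S_weak"
proof
  fix m assume "m \<in> carmichael_numbers"
  then have m: "m > 1" "\<not> prime m" "squarefree m"
    and dvd: "\<And>p. prime p \<Longrightarrow> p dvd m \<Longrightarrow> p - 1 dvd m - 1"
    unfolding korselt_criterion by auto
  have "digit_sum p m \<ge> p" if "prime p" "p dvd m" for p
  proof -
    have p: "p \<ge> 2" using that prime_ge_2_nat by blast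
    have "[m = 1] (mod (p - 1))"
      using dvd[OF that] m by (simp add: cong_altdef_nat)
    then have "[digit_sum p m = 1] (mod (p - 1))"
      using digit_sum_cong[OF p] cong_trans by blast
    moreover have pos: "digit_sum p m \<ge> 1"
      using digit_sum_pos[OF p, of m] m by simp
    ultimately have "p - 1 dvd digit_sum p m - 1"
      by (simp add: cong_altdef_nat)
    moreover have "digit_sum p m \<noteq> 1"
    proof
      assume "digit_sum p m = 1"
      then obtain k where k: "m = p ^ k"
        using digit_sum_eq_1_imp_power[OF p] by blast
      have "k < 2"
      proof (rule ccontr)
        assume "\<not> k < 2"
        then have "p ^ 2 dvd m" unfolding k by (intro le_imp_power_dvd) simp
        then have "p dvd 1" by (rule squarefreeD[OF m(3)])
        then show False using p by simp
      qed
      \<comment> \<open>\<open>k = 0\<close> would give \<open>m = 1\<close>, and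
        \<open>k = 1\<close> would make \<open>m\<close> the prime \<open>p\<close>.\<close>
      then have "k = 0 \<or> k = 1" by linarith
      then show False using k m that by auto
    qed
    ultimately have "p - 1 \<le> digit_sum p m - 1"
      using pos by (intro dvd_imp_le) auto
    then show ?thesis using pos by linarith
  qed
  then show "m \<in> S_weak"
    unfolding S_weak_iff
    using prime_factor_less[OF m(1,2)] m prod_prime_factors_squarefree[OF m(3)]
    by (intro exI[of _ "prime_factors m"] exI[of _ "\<lambda>_. 1"])
      (auto simp: prime_factorization_empty_iff in_prime_factors_iff)
qed

lemma primary_carmichael_subset:
  "primary_carmichael_numbers \<subseteq> S_strict \<inter> carmichael_numbers"
proof
  fix m assume "m \<in> primary_carmichael_numbers"
  then have m: "m > 1" "squarefree m"
    and ds: "\<And>p. prime p \<Longrightarrow> p dvd m \<Longrightarrow> digit_sum p m = p"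
    unfolding primary_carmichael_numbers_def by blast+
  have np: "\<not> prime m"
  proof
    assume p: "prime m"
    \<comment> \<open>In base \<open>m\<close> the number \<open>m\<close> is written 10.\<close>
    have "digit_sum m m = 1"
      using digit_sum_mult_base[of m 1] m by (simp add: digit_sum_less_base)
    then show False using ds[OF p] m by simp
  qed
  have "p - 1 dvd m - 1" if p: "prime p" "p dvd m" for p
  proof -
    have p2: "p \<ge> 2" using p prime_ge_2_nat by blast
    have "[m = p] (mod (p - 1))"
      using digit_sum_cong[OF p2, of m] ds[OF p] by (simp add: cong_sym_eq)
    moreover have "[p = 1] (mod (p - 1))"
      using p2 by (simp add: cong_altdef_nat)
    ultimately have "[m = 1] (mod (p - 1))"
      using cong_trans by blast
    then show ?thesis using m by (simp add: cong_altdef_nat)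
  qed
  then have "m \<in> carmichael_numbers"
    using m np unfolding korselt_criterion by auto
  moreover have "m \<in> S_strict"
    unfolding S_strict_iff
    using prime_factor_less[OF m(1) np] m ds prod_prime_factors_squarefree[OF m(2)]
    by (intro exI[of _ "prime_factors m"] exI[of _ "\<lambda>_. 1"])
      (auto simp: prime_factorization_empty_iff in_prime_factors_iff)
  ultimately show "m \<in> S_strict \<inter> carmichael_numbers" by blast
qed

text \<open>Squarefreeness makes all exponents 1 and the factors pairwise coprime, so the three
  primes are distributed among the factors without overlap, at least one to each. Once there are
  three factors, each gets exactly one prime.\<close>

lemma S_strict_three_prime_factors:
  assumes "m \<in> S_strict" "squarefree m" "card (prime_factors m) = 3"
  shows "m \<in> primary_carmichael_numbers"
proof -
  obtain A e where A: "finite A" "A \<noteq> {}" and e: "\<And>x. x \<in> A \<Longrightarrow> e x \<ge> 1"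
    and bounds: "\<And>x. x \<in> A \<Longrightarrow> 1 < x \<and> x < m"
    and ds: "\<And>x. x \<in> A \<Longrightarrow> digit_sum x m = x" and m: "m = (\<Prod>x\<in>A. x ^ e x)"
    using assms(1)[unfolded S_strict_iff] by (elim exE conjE) metis
  have "m > 1" using A bounds by force
  have "e x = 1" if "x \<in> A" for x
  proof (rule ccontr)
    assume "e x \<noteq> 1"
    then have "x ^ 2 dvd x ^ e x"
      using e[OF that] by (intro le_imp_power_dvd) simp
    also have "\<dots> dvd m"
      unfolding m using A(1) that by (rule dvd_prodI)
    finally have "x dvd 1" by (rule squarefreeD[OF assms(2)])
    then show False using bounds[OF that] by simp
  qed
  then have m': "m = \<Prod>A" using m by simp
  have sf: "squarefree x" if "x \<in> A" for x
    using assms(2) unfolding m'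
    by (rule squarefree_mono[OF dvd_prodI[OF A(1) that]])
  have cop: "coprime x y" if "x \<in> A" "y \<in> A" "x \<noteq> y" for x y
  proof -
    \<comment> \<open>A common divisor of two distinct factors enters the product squared.\<close>
    have "gcd x y ^ 2 dvd x * y"
      unfolding power2_eq_square by (intro mult_dvd_mono) simp_all
    also have "x * y = \<Prod>{x, y}" using that by simp
    also have "\<dots> dvd m"
      unfolding m' using that A(1) by (intro prod_dvd_prod_subset) auto
    finally have "gcd x y dvd 1" by (rule squarefreeD[OF assms(2)])
    then show ?thesis by (rule is_unit_gcd[THEN iffD1])
  qed
  have pf: "prime_factors m = (\<Union>x\<in>A. prime_factors x)"
  proof (rule Set.set_eqI)
    fix p
    have "p dvd m \<longleftrightarrow> (\<exists>x\<in>A. p dvd x)" if "prime p"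
      unfolding m' using A(1) that by (rule prime_dvd_prod_iff)
    moreover have "x \<noteq> 0" if "x \<in> A" for x
      using bounds[OF that] by simp
    ultimately show "p \<in> prime_factors m \<longleftrightarrow> p \<in> (\<Union>x\<in>A. prime_factors x)"
      using \<open>m > 1\<close> by (simp add: in_prime_factors_iff) blast
  qed
  have "card (prime_factors m) = (\<Sum>x\<in>A. card (prime_factors x))"
    unfolding pf
  proof (intro card_UN_disjoint A(1) ballI impI)
    fix x y assume "x \<in> A" "y \<in> A" "x \<noteq> y"
    then have "\<not> prime p" if "p dvd x" "p dvd y" for p
      using cop coprime_common_divisor not_prime_unit that by blast
    then show "prime_factors x \<inter> prime_factors y = {}"
      by (auto simp: in_prime_factors_iff)
  qed simp
  then have sum3: "(\<Sum>x\<in>A. card (prime_factors x)) = 3"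
    using assms(3) by simp
  have ge1: "card (prime_factors x) \<ge> 1" if "x \<in> A" for x
    using bounds[OF that]
    by (auto simp: Suc_le_eq card_gt_0_iff prime_factorization_empty_iff)
  \<comment> \<open>A single factor would be \<open>m\<close> itself, which is not proper.\<close>
  have "card A \<noteq> 1"
    using m' bounds by (auto simp: card_1_singleton_iff)
  moreover have "card A \<noteq> 2"
  proof
    assume "card A = 2"
    then obtain g h where gh: "A = {g, h}" "g \<noteq> h"
      by (auto simp: card_2_iff)
    have no_pair: False if "a < b" "a \<in> A" "b \<in> A" "m = b * a" for a b
    proof -
      \<comment> \<open>In base \<open>b\<close> the number \<open>b * a\<close> is the single digit
        \<open>a\<close> followed by 0.\<close>
      have "digit_sum b m = a"
        using that bounds[of b] by (simp add: digit_sum_mult_base digit_sum_less_base)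
      then show False using ds[of b] that by simp
    qed
    then show False
      using gh m' no_pair[of g h] no_pair[of h g] by (force simp: mult.commute)
  qed
  moreover have "card A \<noteq> 0" using A by simp
  ultimately have card_A: "card A \<ge> 3" by linarith
  have one: "card (prime_factors x) = 1" if "x \<in> A" for x
  proof (rule ccontr)
    assume "card (prime_factors x) \<noteq> 1"
    then have "1 < card (prime_factors x)" using ge1[OF that] by linarith
    \<comment> \<open>A factor with two primes would push the total above \<open>card A\<close>,
      hence above 3.\<close>
    then have "(\<Sum>x\<in>A. 1) < (\<Sum>x\<in>A. card (prime_factors x))"
      using ge1 that by (intro sum_strict_mono_ex1 A(1) ballI bexI[of _ x]) auto
    then show False using sum3 card_A by simp
  qed
  have "digit_sum p m = p" if p: "prime p" "p dvd m" for p
  proof -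
    have "p \<in> prime_factors m" using p \<open>m > 1\<close> by (simp add: in_prime_factors_iff)
    then obtain x where x: "x \<in> A" "p \<in> prime_factors x"
      unfolding pf by blast
    then have "prime_factors x = {p}"
      using one[OF x(1)] by (auto simp: card_1_singleton_iff)
    then have "x = p"
      using prod_prime_factors_squarefree[OF sf[OF x(1)]] by simp
    then show ?thesis using ds x(1) by simp
  qed
  then show ?thesis
    using \<open>m > 1\<close> assms(2) by (simp add: primary_carmichael_numbers_def)
qed

section \<open>Witnesses that the inclusions are proper\<close>

lemma S_weak_24: "24 \<in> S_weak"
  unfolding S_weak_iff
  \<comment> \<open>24 is 11000 in base 2 and 220 in base 3, with digit sums 2 and 4.\<close>
  by (intro exI[of _ "{2, 3}"] exI[of _ "\<lambda>x. if x = 2 then 3 else 1"])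
    (simp add: digit_sum_numeral digit_sum_less_base)

lemma not_carmichael_24: "24 \<notin> carmichael_numbers"
proof
  assume "24 \<in> carmichael_numbers"
  then have "squarefree (24 :: nat)" by (simp add: korselt_criterion)
  then show False using squarefreeD[of "24 :: nat" 2] by simp
qed

lemma S_strict_172081: "172081 \<in> S_strict"
  unfolding S_strict_iff
  \<comment> \<open>The digits are (5, 24, 2, 0) in base 31, (46, 15, 0) in base 61 and (20, 71, 0)
    in base 91.\<close>
  by (intro exI[of _ "{31, 61, 91}"] exI[of _ "\<lambda>_. 1"]) (simp add: digit_sum_numeral digit_sum_less_base)

lemma carmichael_172081: "172081 \<in> carmichael_numbers"
proof -
  have m: "172081 = 7 * (13 * (31 * (61 :: nat)))" by simp
  have primes: "prime (7 :: nat)" "prime (13 :: nat)" "prime (31 :: nat)" "prime (61 :: nat)"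
    by simp_all
  have "coprime (7 :: nat) 13" "coprime (7 :: nat) 31" "coprime (7 :: nat) 61"
      "coprime (13 :: nat) 31" "coprime (13 :: nat) 61" "coprime (31 :: nat) 61"
    by (intro primes_coprime primes; simp)+
  then have "squarefree (172081 :: nat)"
    unfolding m
    by (intro squarefree_mult_coprime squarefree_prime primes)
      (simp_all only: coprime_mult_right_iff simp_thms)
  moreover have "p - 1 dvd 172081 - 1" if p: "prime p" "p dvd 172081" for p :: nat
  proof -
    have "p dvd 7 \<or> p dvd 13 \<or> p dvd 31 \<or> p dvd 61"
      using p(2) unfolding m prime_dvd_mult_iff[OF p(1)] .
    then have "p = 7 \<or> p = 13 \<or> p = 31 \<or> p = 61"
      using primes primes_dvd_imp_eq[OF p(1)] by blast
    \<comment> \<open>6, 12, 30 and 60 all divide 60, and 172080 = 60 * 2868.\<close>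
    then show ?thesis by (elim disjE) simp_all
  qed
  moreover have "\<not> prime (172081 :: nat)"
  proof
    assume "prime (172081 :: nat)"
    then have "(7 :: nat) = 172081" by (rule primes_dvd_imp_eq[OF primes(1)]) simp
    then show False by simp
  qed
  moreover have "(172081 :: nat) > 1" by simp
  ultimately show ?thesis
    unfolding korselt_criterion by blast
qed

text \<open>The prime 7 is hidden inside the factor 91, so the strict decomposition says nothing
  about base 7, where the digit sum is 19.\<close>

lemma not_primary_carmichael_172081: "172081 \<notin> primary_carmichael_numbers"
proof
  assume "172081 \<in> primary_carmichael_numbers"
  moreover have "prime (7 :: nat)" "(7 :: nat) dvd 172081" by simp_all
  ultimately have "digit_sum 7 172081 = 7"
    unfolding primary_carmichael_numbers_def by blast
  then show False by (simp add: digit_sum_numeral digit_sum_less_base)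
qed

theorem theorem2p2:
  shows "carmichael_numbers \<subset> S_weak \<and>
    primary_carmichael_numbers \<subset> S_strict \<inter> carmichael_numbers \<and>
    with_prime_factors primary_carmichael_numbers 3 =
      S_strict \<inter> with_prime_factors carmichael_numbers 3"
proof (intro conjI)
  show "carmichael_numbers \<subset> S_weak"
    using carmichael_subset_S_weak S_weak_24 not_carmichael_24 by blast
  show "primary_carmichael_numbers \<subset> S_strict \<inter> carmichael_numbers"
    using primary_carmichael_subset S_strict_172081 carmichael_172081
      not_primary_carmichael_172081 by blast
  show "with_prime_factors primary_carmichael_numbers 3 =
      S_strict \<inter> with_prime_factors carmichael_numbers 3"
    \<comment> \<open>Korselt's criterion supplies the squarefreeness that
      \<open>S_strict_three_prime_factors\<close> assumes.\<close>
    using primary_carmichael_subset S_strict_three_prime_factors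
    by (auto simp: with_prime_factors_def korselt_criterion)
qed

end
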